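(* For every integer $n\ge1$, $$\lambda_n=\frac{(-1)^n\, n\,\mathrm{i}}{\pi}\int_C I(\sigma)\,d\sigma,\qquad I(\sigma)=\frac{\Gamma(\sigma+n)\,\Gamma(\sigma-n)}{\Gamma(2\sigma+1)}\,Z(\sigma),$$ where $C$ is a positively oriented closed contour encircling, among the poles of the integrand $I(\sigma)$, only the subset $\sigma=+1,\ldots,+n$.
   Context: Let $\zeta$ be the Riemann zeta function. Its nontrivial zeros $\rho$ (counted with multiplicity) are listed in pairs $\{\rho,1-\rho\}$ as $\rho=\tfrac12\pm \mathrm{i}\tau_k$, $k=1,2,\ldots$, with $\{\operatorname{Re}\tau_k\}$ positive and non-decreasing. (The Riemann Hypothesis is not assumed, so the $\tau_k$ may be complex.) Each pair is parametrized by the single number $x_k=\rho(1-\rho)=\tfrac14+\tau_k^2$. All sums and products over zeros are performed with $\rho$ and $1-\rho$ paired together. The Li coefficients are $\lambda_n=\sum_\rho\bigl[1-(1-1/\rho)^n\bigr]$ for $n\ge1$, where the sum is over all nontrivial zeros. Explicitly, it is the sum over $k$ of the two terms for $\rho=\tfrac12+\mathrm{i}\tau_k$ and $\rho=\tfrac12-\mathrm{i}\tau_k$. Equivalently, near $z=0$, $$\frac{d}{dz}\log\Xi\Bigl(\frac1{1-z}\Bigr)=\sum_{n\ge1}\lambda_n z^{n-1},\qquad \Xi(s)=s(s-1)\Gamma(s/2)\pi^{-s/2}\zeta(s).$$ The secondary zeta function is $Z(\sigma)=\sum_{k=1}^\infty x_k^{-\sigma}$ for $\operatorname{Re}\sigma>\tfrac12$.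 It is known to extend to a meromorphic function on $\mathbb{C}$ with a double pole at $\sigma=\tfrac12$ and all its other poles at negative half-integers. The symbol $Z$ denotes this extension. $\Gamma$ is Euler's Gamma function. *)

theory Defs
  imports "HOL-Complex_Analysis.Complex_Analysis"
begin

text \<open>
  The Riemann zeta function as the analytic continuation of its Dirichlet series to the complex
  plane without the point 1.  The continuation is unique there; the value at 1 is unspecified
  and is never used.
\<close>

definition riemann_zeta :: "complex \<Rightarrow> complex" where
  "riemann_zeta = (SOME f. f holomorphic_on - {1} \<and>
     (\<forall>s. Re s > 1 \<longrightarrow> (\<lambda>m. 1 / of_nat (Suc m) powr s) sums f s))"

definition nontrivial_zero :: "complex \<Rightarrow> bool" where
  "nontrivial_zero s \<longleftrightarrow>
     s \<noteq> 1 \<and> riemann_zeta s = 0 \<and> \<not> (\<exists>m::nat. m \<ge> 1 \<and> s = - 2 * of_nat m)"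

definition nontrivial_zero_mult :: "complex \<Rightarrow> int" where
  "nontrivial_zero_mult s = (if nontrivial_zero s then zorder riemann_zeta s else 0)"

text \<open>
  The sequences of this theory are indexed from 0, so \<open>\<tau> k\<close> is the customary \<open>\<tau>\<close> with index
  \<open>k + 1\<close>.  The last two conjuncts say that the points \<open>1/2 + \<i> * \<tau> k\<close> and \<open>1/2 - \<i> * \<tau> k\<close>
  taken together form exactly the multiset of nontrivial zeros.  The finiteness condition is
  needed because \<open>card\<close> is 0 on infinite sets.
\<close>

definition zero_pair_listing :: "(nat \<Rightarrow> complex) \<Rightarrow> bool" where
  "zero_pair_listing \<tau> \<longleftrightarrow>
     (\<forall>k. Re (\<tau> k) > 0) \<and>
     mono (\<lambda>k. Re (\<tau> k)) \<and>
     (\<forall>s. finite {k. 1/2 + \<i> * \<tau> k = s} \<and> finite {k. 1/2 - \<i> * \<tau> k = s}) \<and>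
     (\<forall>s. int (card {k. 1/2 + \<i> * \<tau> k = s}) + int (card {k. 1/2 - \<i> * \<tau> k = s})
            = nontrivial_zero_mult s)"

definition pair_param :: "(nat \<Rightarrow> complex) \<Rightarrow> nat \<Rightarrow> complex" where
  "pair_param \<tau> k = 1/4 + (\<tau> k)\<^sup>2"

definition li_coeff :: "(nat \<Rightarrow> complex) \<Rightarrow> nat \<Rightarrow> complex" where
  "li_coeff \<tau> n = (\<Sum>k. (1 - (1 - 1 / (1/2 + \<i> * \<tau> k)) ^ n)
                       + (1 - (1 - 1 / (1/2 - \<i> * \<tau> k)) ^ n))"

text \<open>
  A meromorphic function on the plane is determined by its values on a half-plane up to its
  values at isolated points, so this predicate fixes the secondary zeta function up to
  (irrelevant) values at isolated points of the half-plane \<open>Re s \<le> 1/2\<close>.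
\<close>

definition is_secondary_zeta :: "(nat \<Rightarrow> complex) \<Rightarrow> (complex \<Rightarrow> complex) \<Rightarrow> bool" where
  "is_secondary_zeta \<tau> Z \<longleftrightarrow>
     Z meromorphic_on UNIV \<and>
     (\<forall>s. Re s > 1/2 \<longrightarrow> (\<lambda>k. pair_param \<tau> k powr (- s)) sums Z s)"

text \<open>
  The \<open>Gamma\<close> function of the library is 0 at its poles, and so is a quotient with denominator 0.
  The pointwise product is therefore not continuous at its removable singularities (for
  instance at \<open>-1/2\<close>), and \<open>remove_sings\<close> restores the values of the meromorphic function
  there, so that a contour may pass through them.
\<close>

definition li_integrand :: "(complex \<Rightarrow> complex) \<Rightarrow> nat \<Rightarrow> complex \<Rightarrow> complex" where
  "li_integrand Z n = remove_sings (\<lambda>s.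
     Gamma (s + of_nat n) * Gamma (s - of_nat n) / Gamma (2 * s + 1) * Z s)"

text \<open>
  A closed contour that encircles the points of \<open>A\<close> once in the positive sense, and no pole of
  \<open>f\<close> outside \<open>A\<close>.  Every positively oriented simple closed contour with the points of \<open>A\<close> inside
  and all other poles outside satisfies this.
\<close>

definition encircles_only ::
    "(real \<Rightarrow> complex) \<Rightarrow> (complex \<Rightarrow> complex) \<Rightarrow> complex set \<Rightarrow> bool" where
  "encircles_only C f A \<longleftrightarrow>
     valid_path C \<and> pathfinish C = pathstart C \<and>
     path_image C \<inter> (A \<union> {s. is_pole f s}) = {} \<and>
     (\<forall>s\<in>A. winding_number C s = 1) \<and>
     (\<forall>s. is_pole f s \<and> s \<notin> A \<longrightarrow> winding_number C s = 0)"

end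

theory Submission
  imports Defs
begin

text \<open>
  For a pair of zeros \<open>\<rho>\<close>, \<open>1 - \<rho>\<close> put \<open>w = 1 - 1/\<rho>\<close>; then \<open>1 - 1/(1 - \<rho>) = 1/w\<close> and
  \<open>w + 1/w = 2 - 1/x\<close> with \<open>x = \<rho>(1 - \<rho>)\<close>, so that \<open>2 - w^n - 1/w^n\<close> is a polynomial in \<open>1/x\<close>
  without constant term, of Chebyshev type.  Summing over the pairs expresses the Li coefficient
  as a combination of \<open>Z 1, \<dots>, Z n\<close>, whose terms are the residues of the integrand at
  \<open>1, \<dots>, n\<close>.

  That \<open>Z\<close> is holomorphic near these points does not follow from the pointwise convergence of its
  series.  It is needed that the zeros lie in a vertical strip: this makes the \<open>x\<^sub>k\<close> eventually have
  nonnegative real part, so convergence at \<open>3/4\<close> is absolute.  The strip comes from the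
  nonvanishing of the Dirichlet series far to the right, applied to \<open>\<rho>\<close> and to \<open>1 - \<rho>\<close>.  As the zeta
  function is given by a choice operator, its analytic continuation has to be constructed first.
\<close>

text \<open>Weierstrass M-test on small closed discs. The majorant may depend on the disc and need
  only hold eventually, because the bound used later for the series of \<open>Z\<close> is valid
  only once \<open>norm (pair_param \<tau> k)\<close> exceeds 1.\<close>

lemma holomorphic_on_suminf:
  fixes f :: "nat \<Rightarrow> complex \<Rightarrow> complex"
  assumes "open S" "\<And>n. f n holomorphic_on S"
    and bound: "\<And>z. z \<in> S \<Longrightarrow> \<exists>d>0. \<exists>M. cball z d \<subseteq> S \<and> summable M \<and>
      (\<forall>\<^sub>F n in sequentially. \<forall>w\<in>cball z d. norm (f n w) \<le> M n)"
  shows "(\<lambda>z. \<Sum>n. f n z) holomorphic_on S"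
proof (rule holomorphic_uniform_sequence[OF assms(1)])
  show "(\<lambda>z. \<Sum>i<n. f i z) holomorphic_on S" for n
    by (intro holomorphic_intros assms)
  fix z assume "z \<in> S"
  from bound[OF this] obtain d M where d: "d > 0" "cball z d \<subseteq> S" and M: "summable M"
    "\<forall>\<^sub>F n in sequentially. \<forall>w\<in>cball z d. norm (f n w) \<le> M n"
    by (elim exE conjE)
  from d show "\<exists>d>0. cball z d \<subseteq> S \<and>
      uniform_limit (cball z d) (\<lambda>n z. \<Sum>i<n. f i z) (\<lambda>z. \<Sum>n. f n z) sequentially"
    using Weierstrass_m_test_ev[OF M(2,1)] by blast
qed

section \<open>Analytic continuation of the Riemann zeta function\<close>

definition dirichlet_zeta :: "complex \<Rightarrow> complex" where
  "dirichlet_zeta s = (\<Sum>m. 1 / of_nat (Suc m) powr s)"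

lemma norm_of_nat_powr: "norm (of_nat (Suc m) powr s :: complex) = real (Suc m) powr Re s"
  using norm_powr_real_powr[of "complex_of_real (real (Suc m))" s] by (simp del: of_nat_Suc)

lemma norm_dirichlet_term: "norm (1 / of_nat (Suc m) powr s :: complex) = real (Suc m) powr (- Re s)"
  by (simp add: norm_divide norm_of_nat_powr powr_minus_divide del: of_nat_Suc)

lemma summable_Suc_powr: "r < - 1 \<Longrightarrow> summable (\<lambda>m. real (Suc m) powr r)"
  using summable_real_powr_iff[of r] summable_Suc_iff[of "\<lambda>m. real m powr r"] by simp

lemma dirichlet_zeta_sums:
  assumes "Re s > 1"
  shows "(\<lambda>m. 1 / of_nat (Suc m) powr s) sums dirichlet_zeta s"
  unfolding dirichlet_zeta_def
  by (rule summable_sums, rule summable_norm_cancel)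
     (use summable_Suc_powr[of "- Re s"] assms in \<open>simp add: norm_dirichlet_term del: of_nat_Suc\<close>)

text \<open>The leading term 1 outweighs the sum of all the others.\<close>

lemma dirichlet_zeta_nonzero:
  assumes "Re s \<ge> 3"
  shows "dirichlet_zeta s \<noteq> 0"
proof -
  let ?f = "\<lambda>m. 1 / of_nat (Suc m) powr s :: complex"
  have sq: "(\<lambda>m. 1 / (real (m + 2))\<^sup>2) sums (pi\<^sup>2 / 6 - 1)"
    using inverse_squares_sums sums_Suc_iff[of "\<lambda>n. 1 / (real (n + 1))\<^sup>2" "pi\<^sup>2 / 6 - 1"]
    by (simp add: add.commute)
  \<comment> \<open>The factor 1/2 comes from trading one of the three powers of
    \<open>m + 2\<close> for 2. With it even the crude bound \<open>pi < 4\<close> keeps the tail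
    below 1, namely at most 5/6.\<close>
  have le: "norm (?f (Suc m)) \<le> 1 / 2 * (1 / (real (m + 2))\<^sup>2)" for m
  proof -
    have "norm (?f (Suc m)) \<le> real (m + 2) powr (- 3)"
      using assms powr_mono[of "- Re s" "- 3" "real (m + 2)"] norm_dirichlet_term[of "Suc m" s] by simp
    also have "\<dots> = 1 / (real (m + 2) * (real (m + 2))\<^sup>2)"
      by (simp add: powr_minus_divide powr_numeral power3_eq_cube power2_eq_square)
    also have "\<dots> \<le> 1 / (2 * (real (m + 2))\<^sup>2)"
      by (intro divide_left_mono mult_right_mono) auto
    finally show ?thesis by simp
  qed
  have "norm (\<Sum>m. ?f (Suc m)) \<le> (\<Sum>m. 1 / 2 * (1 / (real (m + 2))\<^sup>2))"
    by (intro norm_suminf_le le summable_mult) (use sq in \<open>simp add: sums_iff\<close>)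
  also have "\<dots> = 1 / 2 * (pi\<^sup>2 / 6 - 1)"
    using sums_unique[OF sums_mult[OF sq, of "1/2"]] by simp
  also have "\<dots> < 1"
    using pi_less_4 power_strict_mono[of pi 4 2] by simp
  finally have "norm (\<Sum>m. ?f (Suc m)) < 1" .
  moreover have "dirichlet_zeta s = (\<Sum>m. ?f (Suc m)) + 1"
    using suminf_split_head[of ?f] dirichlet_zeta_sums[of s] assms
    by (simp add: dirichlet_zeta_def sums_iff)
  ultimately show ?thesis
    by (metis add_eq_0_iff less_irrefl norm_minus_cancel norm_one)
qed

lemma dirichlet_zeta_holomorphic: "dirichlet_zeta holomorphic_on {s. Re s > 1}"
  unfolding dirichlet_zeta_def
proof (rule holomorphic_on_suminf)
  show "open {s. Re s > 1}" by (rule open_halfspace_Re_gt)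
  show "(\<lambda>s. 1 / of_nat (Suc n) powr s) holomorphic_on {s. Re s > 1}" for n
    by (intro holomorphic_intros) (auto simp del: of_nat_Suc)
  fix z :: complex assume z: "z \<in> {s. Re s > 1}"
  define d where "d = (Re z - 1) / 2"
  have d: "Re w \<ge> 1 + d" if "w \<in> cball z d" for w
    using that abs_Re_le_cmod[of "z - w"] by (simp add: dist_norm d_def field_simps)
  show "\<exists>d>0. \<exists>M. cball z d \<subseteq> {s. Re s > 1} \<and> summable M \<and>
      (\<forall>\<^sub>F n in sequentially. \<forall>w\<in>cball z d. norm (1 / of_nat (Suc n) powr w :: complex) \<le> M n)"
  proof (intro exI conjI always_eventually allI ballI)
    show "d > 0" using z by (simp add: d_def)
    then show "cball z d \<subseteq> {s. Re s > 1}" using d by fastforce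
    show "summable (\<lambda>m. real (Suc m) powr (- (1 + d)))"
      using \<open>d > 0\<close> by (intro summable_Suc_powr) simp
    show "norm (1 / of_nat (Suc n) powr w :: complex) \<le> real (Suc n) powr (- (1 + d))"
      if "w \<in> cball z d" for n w
      using d[OF that] by (simp add: norm_dirichlet_term powr_mono del: of_nat_Suc)
  qed
qed

section \<open>Binomial expansion with a uniform remainder\<close>

lemma fact_gbinomial_Suc:
  fixes a :: complex
  shows "fact (Suc i) * (a gchoose Suc i) = fact i * (a gchoose i) * (a - of_nat i)"
  by (simp add: gbinomial_prod_rev atLeast0LessThan mult.commute del: fact_Suc)

lemma norm_fact_gbinomial_le:
  fixes a :: complex
  assumes "norm a \<le> B"
  shows "norm (fact i * (a gchoose i)) \<le> (B + real i) ^ i"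
proof -
  have "norm (fact i * (a gchoose i)) = (\<Prod>l<i. norm (a - of_nat l))"
    by (simp add: gbinomial_prod_rev atLeast0LessThan prod_norm)
  also have "\<dots> \<le> (\<Prod>l<i. B + real i)"
  proof (intro prod_mono conjI)
    fix l assume "l \<in> {..<i}"
    then show "norm (a - of_nat l) \<le> B + real i"
      using norm_triangle_ineq4[of a "of_nat l"] assms by simp
  qed auto
  finally show ?thesis by simp
qed

text \<open>Taylor's theorem for \<open>(1 + z) powr a\<close> on the segment from 0 to 1, which
  avoids the branch cut. The constant depends on \<open>a\<close> only through \<open>B\<close>, so
  that it can serve in an M-test over a disc of exponents.\<close>

lemma binomial_remainder_bound:
  fixes a :: complex and x :: real
  assumes a: "norm a \<le> B" and x: "0 \<le> x" "x \<le> 1"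
  shows "norm ((1 + of_real x) powr a - (\<Sum>j\<le>K. (a gchoose j) * of_real x ^ j))
    \<le> (B + real (Suc K)) ^ Suc K * 2 powr B * x ^ Suc K"
proof -
  \<comment> \<open>The \<open>i\<close>-th derivative of \<open>(1 + z) powr a\<close>:
    \<open>fact i * (a gchoose i)\<close> is the falling factorial.\<close>
  define f where "f i z = fact i * (a gchoose i) * (1 + z) powr (a - of_nat i)" for i and z :: complex
  define S where "S = complex_of_real ` {0..1}"
  let ?B = "(B + real (Suc K)) ^ Suc K * 2 powr B"
  have B: "B \<ge> 0" using a norm_ge_zero order_trans by blast
  have "norm (f 0 (of_real x) - (\<Sum>i\<le>K. f i 0 * (of_real x - 0) ^ i / fact i))
      \<le> ?B * norm (of_real x - 0 :: complex) ^ Suc K / fact K"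
  proof (rule complex_Taylor)
    show "convex S"
      unfolding S_def by (intro convex_linear_image) (auto simp: linear_of_real)
    show "(f i has_field_derivative f (Suc i) z) (at z within S)" if "z \<in> S" for i z
    proof -
      have "1 + z \<notin> \<real>\<^sub>\<le>\<^sub>0" using that by (auto simp: S_def complex_nonpos_Reals_iff)
      then show ?thesis
        unfolding f_def fact_gbinomial_Suc
        by (auto intro!: derivative_eq_intros simp: algebra_simps)
    qed
    show "norm (f (Suc K) z) \<le> ?B" if z: "z \<in> S" for z
    proof -
      obtain y where y: "z = of_real y" "0 \<le> y" "y \<le> 1" using z by (auto simp: S_def)
      have "norm ((1 + z) powr (a - of_nat (Suc K))) = (1 + y) powr (Re a - real (Suc K))"
        using y norm_powr_real_powr[of "of_real (1 + y)" "a - of_nat (Suc K)"]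
        by simp
      also have "\<dots> \<le> (1 + y) powr B"
        using y a abs_Re_le_cmod[of a] by (intro powr_mono) auto
      also have "\<dots> \<le> 2 powr B"
        using y B by (intro powr_mono2) auto
      finally show ?thesis
        unfolding f_def norm_mult[of "_ * _" "_ powr _"]
        using B by (intro mult_mono norm_fact_gbinomial_le a) auto
    qed
    show "(0::complex) \<in> S" "of_real x \<in> S" using x by (auto simp: S_def image_iff)
  qed
  also have "\<dots> \<le> ?B * x ^ Suc K / 1"
    using x B by (intro frac_le) (auto simp: fact_ge_1)
  finally show ?thesis by (simp add: f_def)
qed

text \<open>Complex powers may be split over this product since both factors are positive
  reals.\<close>

lemma Suc_powr_eq:
  "of_nat (m + 2) powr s = of_nat (Suc m) powr s * (1 + of_real (1 / real (Suc m))) powr (s :: complex)"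
proof -
  have "of_nat (m + 2) = complex_of_real (real (Suc m)) * complex_of_real (1 + 1 / real (Suc m))"
    unfolding of_real_mult[symmetric] by (subst of_real_of_nat_eq[symmetric], subst of_real_eq_iff) (simp add: field_simps)
  moreover have "\<dots> powr s = complex_of_real (real (Suc m)) powr s * complex_of_real (1 + 1 / real (Suc m)) powr s"
    by (rule powr_times_real) (auto simp del: of_nat_Suc of_real_add)
  ultimately show ?thesis by (simp del: of_nat_Suc)
qed

text \<open>With N = \<open>Suc m\<close>, the error in expanding (N + 1)^(-t) in powers of 1/N up
  to order \<open>K\<close>. It is of size N^(-Re t - K - 1), hence summable for Re t > -K.\<close>

definition zeta_remainder :: "nat \<Rightarrow> nat \<Rightarrow> complex \<Rightarrow> complex" where
  "zeta_remainder K m t = of_nat (m + 2) powr (- t) -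
     (\<Sum>j\<le>K. (- t gchoose j) * of_nat (Suc m) powr (- t - of_nat j))"

lemma norm_zeta_remainder_le:
  assumes "norm t \<le> B"
  shows "norm (zeta_remainder K m t) \<le>
    (B + real (Suc K)) ^ Suc K * 2 powr B * real (Suc m) powr (- Re t - real (Suc K))"
proof -
  let ?x = "1 / real (Suc m)" and ?N = "of_nat (Suc m) :: complex"
  have "?N powr (- t - of_nat j) = ?N powr (- t) * of_real ?x ^ j" for j
    using powr_nat'[of ?N j] by (simp add: powr_diff power_divide del: of_nat_Suc)
  then have "zeta_remainder K m t = ?N powr (- t) *
      ((1 + of_real ?x) powr (- t) - (\<Sum>j\<le>K. (- t gchoose j) * of_real ?x ^ j))"
    unfolding zeta_remainder_def Suc_powr_eq
    by (simp add: right_diff_distrib sum_distrib_left mult_ac del: of_nat_Suc of_real_divide)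
  then have "norm (zeta_remainder K m t) = real (Suc m) powr (- Re t) *
      norm ((1 + of_real ?x) powr (- t) - (\<Sum>j\<le>K. (- t gchoose j) * of_real ?x ^ j))"
    by (simp add: norm_mult norm_of_nat_powr del: of_nat_Suc of_real_divide)
  also have "\<dots> \<le> real (Suc m) powr (- Re t) *
      ((B + real (Suc K)) ^ Suc K * 2 powr B * ?x ^ Suc K)"
    by (intro mult_left_mono binomial_remainder_bound) (use assms in auto)
  also have "\<dots> = (B + real (Suc K)) ^ Suc K * 2 powr B *
      real (Suc m) powr (- Re t - real (Suc K))"
    by (simp add: powr_diff powr_realpow power_divide del: of_nat_Suc power_Suc)
  finally show ?thesis .
qed

lemma of_nat_powr_tendsto_0:
  assumes "Re t > 0"
  shows "(\<lambda>m. of_nat (Suc m) powr (- t) :: complex) \<longlonglongrightarrow> 0"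
proof (rule tendsto_norm_zero_cancel)
  have "(\<lambda>m. real (Suc m) powr (- Re t)) \<longlonglongrightarrow> 0"
    using assms by (intro tendsto_neg_powr filterlim_compose[OF filterlim_real_sequentially filterlim_Suc]) auto
  then show "(\<lambda>m. norm (of_nat (Suc m) powr (- t) :: complex)) \<longlonglongrightarrow> 0"
    by (simp add: norm_of_nat_powr del: of_nat_Suc)
qed

text \<open>
  Expand \<open>(n + 1) powr (- t)\<close> in powers of \<open>1/n\<close> in the telescoping series
  \<open>1 = (\<Sum>n. n powr (- t) - (n + 1) powr (- t))\<close>.  The values at \<open>t + 2, \<dots>, t + K\<close> and the
  remainder make sense further to the left than the value at \<open>t + 1\<close>.
\<close>

lemma dirichlet_zeta_recursion:
  assumes t: "Re t > 0" and K: "K \<ge> 1"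
  shows "t * dirichlet_zeta (t + 1) =
    1 + (\<Sum>j\<in>{2..K}. (- t gchoose j) * dirichlet_zeta (t + of_nat j)) + (\<Sum>m. zeta_remainder K m t)"
proof -
  let ?N = "\<lambda>m. of_nat (Suc m) :: complex" and ?D = "\<lambda>j. (- t gchoose j) * dirichlet_zeta (t + of_nat j)"
  have "(\<lambda>m. ?N (Suc m) powr (- t) - ?N m powr (- t)) sums (0 - ?N 0 powr (- t))"
    by (rule telescope_sums[OF of_nat_powr_tendsto_0[OF t]])
  then have tele: "(\<lambda>m. ?N (Suc m) powr (- t) - ?N m powr (- t)) sums (- 1)"
    by simp
  have "(\<lambda>m. ?N m powr (- t - of_nat j)) sums dirichlet_zeta (t + of_nat j)" if "j \<ge> 1" for j
  proof -
    have "?N m powr (- t - of_nat j) = 1 / ?N m powr (t + of_nat j)" for m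
      using powr_minus_divide[of "?N m" "t + of_nat j"] by (simp add: algebra_simps del: of_nat_Suc)
    then show ?thesis
      using dirichlet_zeta_sums[of "t + of_nat j"] t that by (simp del: of_nat_Suc)
  qed
  then have "(\<lambda>m. \<Sum>j\<in>{1..K}. (- t gchoose j) * ?N m powr (- t - of_nat j)) sums (\<Sum>j\<in>{1..K}. ?D j)"
    by (intro sums_sum sums_mult) auto
  from sums_diff[OF tele this]
  have "(\<lambda>m. ?N (Suc m) powr (- t) - ?N m powr (- t) -
      (\<Sum>j\<in>{1..K}. (- t gchoose j) * ?N m powr (- t - of_nat j))) sums (- 1 - (\<Sum>j\<in>{1..K}. ?D j))" .
  moreover have "{..K} = insert 0 {1..K}" by auto
  then have "zeta_remainder K m t = ?N (Suc m) powr (- t) - ?N m powr (- t) -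
      (\<Sum>j\<in>{1..K}. (- t gchoose j) * ?N m powr (- t - of_nat j))" for m
    unfolding zeta_remainder_def by (simp del: of_nat_Suc)
  ultimately have "(\<Sum>m. zeta_remainder K m t) = - 1 - (\<Sum>j\<in>{1..K}. ?D j)"
    by (simp add: sums_iff)
  \<comment> \<open>The term j = 1 has coefficient \<open>- t\<close> and becomes the left-hand side
    of the recursion.\<close>
  moreover have "{1..K} = insert 1 {2..K}" using K by auto
  then have "(\<Sum>j\<in>{1..K}. ?D j) = - t * dirichlet_zeta (t + 1) + (\<Sum>j\<in>{2..K}. ?D j)"
    by simp
  ultimately show ?thesis by (simp add: algebra_simps del: One_nat_def)
qed

lemma holomorphic_on_gbinomial [holomorphic_intros]:
  "f holomorphic_on S \<Longrightarrow> (\<lambda>z. f z gchoose n) holomorphic_on S"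
  unfolding gbinomial_prod_rev by (intro holomorphic_intros) auto

lemma suminf_zeta_remainder_holomorphic:
  "(\<lambda>t. \<Sum>m. zeta_remainder K m t) holomorphic_on {t. Re t > - real K}"
proof (rule holomorphic_on_suminf)
  show "open {t. Re t > - real K}" by (rule open_halfspace_Re_gt)
  show "zeta_remainder K m holomorphic_on {t. Re t > - real K}" for m
    unfolding zeta_remainder_def by (intro holomorphic_intros) (auto simp del: of_nat_Suc)
  fix z :: complex assume z: "z \<in> {t. Re t > - real K}"
  define d where "d = (Re z + real K) / 2"
  define B where "B = norm z + d"
  define C where "C = (B + real (Suc K)) ^ Suc K * 2 powr B"
  have "d > 0" using z by (simp add: d_def)
  then have "C \<ge> 0" by (simp add: B_def C_def)
  have d: "Re w \<ge> d - real K" "norm w \<le> B" if "w \<in> cball z d" for w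
    using that abs_Re_le_cmod[of "z - w"] norm_triangle_sub[of w z]
    by (auto simp: dist_norm d_def B_def field_simps norm_minus_commute)
  have "cball z d \<subseteq> {t. Re t > - real K}" using d \<open>d > 0\<close> by fastforce
  moreover have "summable (\<lambda>m. C * real (Suc m) powr (- d - 1))"
    using \<open>d > 0\<close> by (intro summable_mult summable_Suc_powr) simp
  moreover have "norm (zeta_remainder K m w) \<le> C * real (Suc m) powr (- d - 1)"
    if w: "w \<in> cball z d" for m w
  proof -
    have "norm (zeta_remainder K m w) \<le> C * real (Suc m) powr (- Re w - real (Suc K))"
      unfolding C_def by (rule norm_zeta_remainder_le[OF d(2)[OF w]])
    also have "\<dots> \<le> C * real (Suc m) powr (- d - 1)"
      using d(1)[OF w] \<open>C \<ge> 0\<close> by (intro mult_left_mono powr_mono) auto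
    finally show ?thesis .
  qed
  ultimately show "\<exists>d>0. \<exists>M. cball z d \<subseteq> {t. Re t > - real K} \<and> summable M \<and>
      (\<forall>\<^sub>F m in sequentially. \<forall>w\<in>cball z d. norm (zeta_remainder K m w) \<le> M m)"
    using \<open>d > 0\<close> by (intro exI[of _ d] exI[of _ "\<lambda>m. C * real (Suc m) powr (- d - 1)"] conjI
        always_eventually allI ballI)
qed

text \<open>Each use of the recursion at t = s - 1 gains a strip of width 1, since it evaluates
  \<open>F\<close> only at points at least one unit further right. The factor s - 1 removes the pole
  at 1.\<close>

lemma zeta_continuation_halfplane:
  "\<exists>F. F holomorphic_on {s. Re s > 1 - real N} \<and> (\<forall>s. Re s > 1 \<longrightarrow> F s = (s - 1) * dirichlet_zeta s)"
proof (induction N)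
  case 0
  have "(\<lambda>s. (s - 1) * dirichlet_zeta s) holomorphic_on {s. Re s > 1 - real 0}"
    using dirichlet_zeta_holomorphic by (auto intro!: holomorphic_intros)
  then show ?case by blast
next
  case (Suc N)
  then obtain F where F: "F holomorphic_on {s. Re s > 1 - real N}"
    and F_eq: "\<And>s. Re s > 1 \<Longrightarrow> F s = (s - 1) * dirichlet_zeta s" by blast
  define K where "K = Suc N"
  \<comment> \<open>The coefficient \<open>(1 - s) gchoose j\<close> of the recursion vanishes at the pole \<open>s = 2 - j\<close> of the
    \<open>j\<close>-th zeta value; cancelling leaves \<open>(1 - s) gchoose (j - 1)\<close>.\<close>
  define G where "G s = 1 - (\<Sum>j\<in>{2..K}. ((1 - s) gchoose (j - 1)) / of_nat j * F (s - 1 + of_nat j)) +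
    (\<Sum>m. zeta_remainder K m (s - 1))" for s
  let ?H = "{s. Re s > 1 - real (Suc N)}"
  have "(\<lambda>s. F (s - 1 + of_nat j)) holomorphic_on ?H" if "j \<ge> 2" for j
    using that by (intro holomorphic_on_compose_gen[OF _ F, unfolded o_def] holomorphic_intros) auto
  moreover have "(\<lambda>s. \<Sum>m. zeta_remainder K m (s - 1)) holomorphic_on ?H"
    by (rule holomorphic_on_compose_gen[OF _ suminf_zeta_remainder_holomorphic, unfolded o_def])
       (auto intro!: holomorphic_intros simp: K_def)
  ultimately have "G holomorphic_on ?H"
    unfolding G_def by (intro holomorphic_intros) auto
  moreover have "G s = (s - 1) * dirichlet_zeta s" if s: "Re s > 1" for s
  proof -
    define t where "t = s - 1"
    have t: "s = t + 1" "1 - s = - t" "Re t > 0" using s by (auto simp: t_def)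
    have "(- t gchoose j) * dirichlet_zeta (t + of_nat j) =
        - ((- t gchoose (j - 1)) / of_nat j * F (t + of_nat j))" if j: "j \<in> {2..K}" for j
    proof -
      obtain i where i: "j = Suc i" using j by (cases j) auto
      have "- t * (- t gchoose i) = of_nat i * (- t gchoose i) + of_nat j * (- t gchoose j)"
        unfolding i by (rule gbinomial_mult_1)
      then have "(- t gchoose j) = - ((- t gchoose i) / of_nat j * (t + of_nat i))"
        using i by (simp add: field_simps del: of_nat_Suc)
      moreover have "F (t + of_nat j) = (t + of_nat i) * dirichlet_zeta (t + of_nat j)"
        using F_eq[of "t + of_nat j"] t i by simp
      ultimately show ?thesis by (simp add: i del: of_nat_Suc)
    qed
    then have "(\<Sum>j\<in>{2..K}. (- t gchoose j) * dirichlet_zeta (t + of_nat j)) =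
        - (\<Sum>j\<in>{2..K}. (- t gchoose (j - 1)) / of_nat j * F (t + of_nat j))"
      by (simp add: sum_negf)
    then show ?thesis
      using dirichlet_zeta_recursion[OF t(3), of K] by (simp add: G_def t K_def)
  qed
  ultimately show ?case by blast
qed

text \<open>The half-plane continuations agree on overlaps by the identity theorem, so they glue to
  an entire function, which is then divided by s - 1.\<close>

lemma zeta_continuation_exists:
  "\<exists>f. f holomorphic_on - {1} \<and> (\<forall>s. Re s > 1 \<longrightarrow> f s = dirichlet_zeta s)"
proof -
  obtain F where F: "\<And>N. F N holomorphic_on {s. Re s > 1 - real N}"
    and F_eq: "\<And>N s. Re s > 1 \<Longrightarrow> F N s = (s - 1) * dirichlet_zeta s"
    using zeta_continuation_halfplane by metis
  have agree: "F M s = F N s" if "M \<le> N" "Re s > 1 - real M" for M N s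
  proof (rule analytic_continuation_open[of "{s. Re s > 1}" "{s. Re s > 1 - real M}" "F M" "F N"])
    show "F N holomorphic_on {s. Re s > 1 - real M}"
      by (rule holomorphic_on_subset[OF F]) (use that in auto)
    show "{s. Re s > 1} \<noteq> {}" by (auto intro: exI[of _ 2])
    show "connected {s. Re s > 1 - real M}"
      by (intro convex_connected convex_halfspace_Re_gt)
  qed (use F F_eq that in \<open>auto simp: open_halfspace_Re_gt\<close>)
  \<comment> \<open>The index is chosen so that \<open>s\<close> lies in the half-plane Re s > 1 -
    N.\<close>
  define G where "G s = F (nat \<lceil>2 - Re s\<rceil>) s" for s
  have G_eq: "G s = F N s" if "Re s > 1 - real N" for s N
  proof -
    let ?M = "nat \<lceil>2 - Re s\<rceil>"
    have "Re s > 1 - real ?M" by linarith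
    then show ?thesis
      using agree[of ?M N s] agree[of N ?M s] that by (cases "?M \<le> N") (auto simp: G_def)
  qed
  have "G holomorphic_on (\<Union>N. {s. Re s > 1 - real N})"
    by (rule holomorphic_on_UN_open, rule holomorphic_transform[OF F])
       (auto simp: G_eq open_halfspace_Re_gt)
  moreover have "(\<Union>N. {s. Re s > 1 - real N}) = UNIV"
  proof -
    have "\<exists>N. Re s > 1 - real N" for s
      using reals_Archimedean2[of "1 - Re s"] by (auto simp: algebra_simps)
    then show ?thesis by auto
  qed
  ultimately have "(\<lambda>s. G s / (s - 1)) holomorphic_on - {1}"
    by (intro holomorphic_intros) (auto intro: holomorphic_on_subset)
  moreover have "G s / (s - 1) = dirichlet_zeta s" if "Re s > 1" for s
    using G_eq[of 0 s] F_eq[of s 0] that by auto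
  ultimately show ?thesis by blast
qed

text \<open>The choice operator delivers the specified properties only after a witness is known; the
  continuation just built is that witness.\<close>

lemma riemann_zeta_eq_dirichlet_zeta:
  assumes "Re s > 1"
  shows "riemann_zeta s = dirichlet_zeta s"
proof -
  let ?P = "\<lambda>f. f holomorphic_on - {1} \<and>
     (\<forall>s. Re s > 1 \<longrightarrow> (\<lambda>m. 1 / of_nat (Suc m) powr s) sums f s)"
  have "\<exists>f. ?P f" using zeta_continuation_exists dirichlet_zeta_sums by metis
  then have "?P riemann_zeta" unfolding riemann_zeta_def by (rule someI_ex)
  then show ?thesis using assms dirichlet_zeta_sums sums_unique2 by blast
qed

section \<open>The nontrivial zeros and the secondary zeta function\<close>

text \<open>At any other point the multiplicity is 0, so both cardinalities vanish; by finiteness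
  the index sets are then truly empty.\<close>

lemma zero_pair_listing_nontrivial_zero:
  assumes "zero_pair_listing \<tau>"
  shows "nontrivial_zero (1/2 + \<i> * \<tau> k)" "nontrivial_zero (1/2 - \<i> * \<tau> k)"
proof -
  have zero: "nontrivial_zero s" if s: "s = 1/2 + \<i> * \<tau> k \<or> s = 1/2 - \<i> * \<tau> k" for s
  proof (rule ccontr)
    assume "\<not> nontrivial_zero s"
    then have "nontrivial_zero_mult s = 0" by (simp add: nontrivial_zero_mult_def)
    moreover from assms have "int (card {k. 1/2 + \<i> * \<tau> k = s}) + int (card {k. 1/2 - \<i> * \<tau> k = s})
        = nontrivial_zero_mult s"
      and fin: "finite {k. 1/2 + \<i> * \<tau> k = s}" "finite {k. 1/2 - \<i> * \<tau> k = s}"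
      unfolding zero_pair_listing_def by blast+
    ultimately have "card {k. 1/2 + \<i> * \<tau> k = s} = 0" "card {k. 1/2 - \<i> * \<tau> k = s} = 0"
      by linarith+
    with fin have "{k. 1/2 + \<i> * \<tau> k = s} = {}" "{k. 1/2 - \<i> * \<tau> k = s} = {}"
      by simp_all
    then show False using s by auto
  qed
  show "nontrivial_zero (1/2 + \<i> * \<tau> k)" "nontrivial_zero (1/2 - \<i> * \<tau> k)"
    using zero by auto
qed

text \<open>No nontrivial zero equals 1 by definition. Since \<rho> and 1 - \<rho> are both listed,
  neither can be 0.\<close>

lemma pair_param_nonzero:
  assumes "zero_pair_listing \<tau>"
  shows "1/2 + \<i> * \<tau> k \<noteq> 0" "1/2 - \<i> * \<tau> k \<noteq> 0" "pair_param \<tau> k \<noteq> 0"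
proof -
  let ?a = "1/2 + \<i> * \<tau> k" and ?b = "1/2 - \<i> * \<tau> k"
  have "?a \<noteq> 1" "?b \<noteq> 1"
    using zero_pair_listing_nontrivial_zero[OF assms, of k] by (auto simp: nontrivial_zero_def)
  moreover have "?a + ?b = 1" by simp
  ultimately show "?a \<noteq> 0" "?b \<noteq> 0"
    by (metis add_0_left, metis add_0_right)
  moreover have "pair_param \<tau> k = (1/2 + \<i> * \<tau> k) * (1/2 - \<i> * \<tau> k)"
    by (simp add: pair_param_def algebra_simps power2_eq_square)
  ultimately show "pair_param \<tau> k \<noteq> 0" by simp
qed

section \<open>Absolute convergence and holomorphy of the secondary zeta function\<close>

text \<open>The two zeros of a pair have real parts 1/2 - Im \<tau> and 1/2 + Im \<tau>, both below
  3.\<close>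

lemma abs_Im_less:
  assumes "zero_pair_listing \<tau>"
  shows "\<bar>Im (\<tau> k)\<bar> < 5/2"
proof -
  have "Re s < 3" if "nontrivial_zero s" for s
    using that riemann_zeta_eq_dirichlet_zeta[of s] dirichlet_zeta_nonzero[of s]
    by (force simp: nontrivial_zero_def)
  from this[OF zero_pair_listing_nontrivial_zero(1)[OF assms]]
    this[OF zero_pair_listing_nontrivial_zero(2)[OF assms]]
  have "Re (1/2 + \<i> * \<tau> k) < 3" "Re (1/2 - \<i> * \<tau> k) < 3" by auto
  then show ?thesis by simp
qed

text \<open>A negative real part forces (Re \<tau>)^2 < 25/4 - 1/4 = 6, and then the norm is less
  than 1/4 + 6 + 25/4 = 12.5 < 13.\<close>

lemma Re_pair_param_nonneg:
  assumes "\<bar>Im (\<tau> k)\<bar> < 5/2" "norm (pair_param \<tau> k) \<ge> 13"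
  shows "Re (pair_param \<tau> k) \<ge> 0"
proof (rule ccontr)
  assume neg: "\<not> ?thesis"
  have b: "(Im (\<tau> k))\<^sup>2 < 25/4"
    using abs_square_less_1[of "Im (\<tau> k) / (5/2)"] assms(1)
    by (simp add: power_divide)
  have "Re (pair_param \<tau> k) = 1/4 + (Re (\<tau> k))\<^sup>2 - (Im (\<tau> k))\<^sup>2"
    by (simp add: pair_param_def power2_eq_square)
  then have a: "(Re (\<tau> k))\<^sup>2 < 6" using neg b by simp
  have "norm (pair_param \<tau> k) \<le> norm (1/4 :: complex) + (norm (\<tau> k))\<^sup>2"
    unfolding pair_param_def by (metis norm_power norm_triangle_ineq)
  also have "(norm (\<tau> k))\<^sup>2 = (Re (\<tau> k))\<^sup>2 + (Im (\<tau> k))\<^sup>2"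
    by (rule cmod_power2)
  finally show False using a b assms(2) by simp
qed

text \<open>
  The exponent \<open>3/4\<close> lies in \<open>{1/2<..<1}\<close>: the series for \<open>Z\<close> converges there, and the powers of
  numbers with nonnegative real part have arguments bounded away from \<open>\<plusminus>pi/2\<close>.
\<close>

lemma norm_powr_le_Re_powr:
  fixes z :: complex
  assumes "z \<noteq> 0" "Re z \<ge> 0"
  shows "cos (3 * pi / 8) * norm z powr (- (3/4)) \<le> Re (z powr (- (3/4)))"
proof -
  let ?\<theta> = "3/4 * Im (Ln z)"
  have "\<bar>?\<theta>\<bar> \<le> 3 * pi / 8" using Re_Ln_pos_le[of z] assms by (simp add: abs_mult)
  then have "cos (3 * pi / 8) \<le> cos \<bar>?\<theta>\<bar>"
    by (intro cos_monotone_0_pi_le) auto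
  then have "cos (3 * pi / 8) \<le> cos ?\<theta>" by (simp only: cos_abs_real)
  moreover have "Re (z powr (- (3/4))) = norm z powr (- (3/4)) * cos ?\<theta>"
    using assms by (simp add: powr_def Re_exp)
  ultimately show ?thesis by (metis mult.commute mult_right_mono powr_ge_zero)
qed

text \<open>The norm of z^(-s) is |z|^(-Re s) times exp(Im s * arg z), and the argument is at most
  pi in absolute value.\<close>

lemma norm_powr_uminus_le:
  fixes z s :: complex
  assumes "norm z \<ge> 1" "Re s \<ge> r"
  shows "norm (z powr (- s)) \<le> exp (pi * \<bar>Im s\<bar>) * norm z powr (- r)"
proof -
  have z: "z \<noteq> 0" using assms by auto
  have "Im s * Im (Ln z) \<le> \<bar>Im s\<bar> * pi"
    using mpi_less_Im_Ln[OF z] Im_Ln_le_pi[OF z] abs_le_D1[of "Im s * Im (Ln z)" "\<bar>Im s\<bar> * pi"]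
    by (simp add: abs_mult mult_left_mono abs_le_iff)
  moreover have "- (Re s * ln (norm z)) \<le> - (r * ln (norm z))"
    using assms by (simp add: mult_right_mono)
  ultimately have "- (Re s * ln (norm z)) + Im s * Im (Ln z) \<le> pi * \<bar>Im s\<bar> + - (r * ln (norm z))"
    by (simp add: mult.commute)
  then show ?thesis
    using z by (simp add: powr_def mult_exp_exp)
qed

text \<open>The terms 1/x of the convergent series for \<open>Z 1\<close> tend to 0.\<close>

lemma norm_pair_param_unbounded:
  assumes "zero_pair_listing \<tau>" "is_secondary_zeta \<tau> Z" "r > 0"
  shows "\<forall>\<^sub>F k in sequentially. norm (pair_param \<tau> k) > r"
proof -
  have "(\<lambda>k. pair_param \<tau> k powr (- 1)) sums Z 1"
    using assms(2) by (simp add: is_secondary_zeta_def)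
  then have "(\<lambda>k. pair_param \<tau> k powr (- 1)) \<longlonglongrightarrow> 0"
    by (intro summable_LIMSEQ_zero sums_summable)
  then have "(\<lambda>k. norm (pair_param \<tau> k powr (- 1))) \<longlonglongrightarrow> 0"
    by (rule tendsto_norm_zero)
  moreover have "1 / r > 0" using assms(3) by simp
  ultimately have "\<forall>\<^sub>F k in sequentially. norm (pair_param \<tau> k powr (- 1)) < 1 / r"
    by (rule order_tendstoD(2))
  then show ?thesis
  proof eventually_elim
    case (elim k)
    have nz: "pair_param \<tau> k \<noteq> 0" by (rule pair_param_nonzero[OF assms(1)])
    then have eq: "norm (pair_param \<tau> k powr (- 1)) = 1 / norm (pair_param \<tau> k)"
      by (simp add: powr_minus norm_inverse divide_inverse)
    then show ?case
      using elim[unfolded eq] nz assms(3) by (simp add: field_simps)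
  qed
qed

text \<open>Convergence at 3/4 is given only in the listed order. The real parts of the terms also
  form a convergent series, and they eventually dominate a positive multiple of the norms.\<close>

lemma summable_norm_pair_param:
  assumes "zero_pair_listing \<tau>" "is_secondary_zeta \<tau> Z"
  shows "summable (\<lambda>k. norm (pair_param \<tau> k) powr (- (3/4)))"
proof -
  define c where "c = cos (3 * pi / 8)"
  have c: "c > 0" unfolding c_def by (rule cos_gt_zero) auto
  have "(\<lambda>k. pair_param \<tau> k powr (- (3/4))) sums Z (3/4)"
    using assms(2) by (simp add: is_secondary_zeta_def)
  then have "summable (\<lambda>k. Re (pair_param \<tau> k powr (- (3/4))))"
    by (intro summable_Re sums_summable)
  then have "summable (\<lambda>k. Re (pair_param \<tau> k powr (- (3/4))) / c)"
    by (rule summable_divide)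
  moreover have "\<forall>\<^sub>F k in sequentially. norm (norm (pair_param \<tau> k) powr (- (3/4)))
      \<le> Re (pair_param \<tau> k powr (- (3/4))) / c"
    using norm_pair_param_unbounded[OF assms, of 13, simplified]
  proof eventually_elim
    case (elim k)
    have "Re (pair_param \<tau> k) \<ge> 0"
      by (rule Re_pair_param_nonneg) (use elim abs_Im_less[OF assms(1)] in auto)
    then have "c * norm (pair_param \<tau> k) powr (- (3/4)) \<le> Re (pair_param \<tau> k powr (- (3/4)))"
      unfolding c_def by (intro norm_powr_le_Re_powr pair_param_nonzero[OF assms(1)])
    then show ?case using c by (simp add: field_simps)
  qed
  ultimately show ?thesis by (rule summable_comparison_test_ev[rotated])
qed

lemma secondary_zeta_holomorphic:
  assumes "zero_pair_listing \<tau>" "is_secondary_zeta \<tau> Z"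
  shows "Z holomorphic_on {s. Re s > 3/4}"
proof (rule holomorphic_transform)
  let ?x = "pair_param \<tau>"
  show "(\<lambda>s. \<Sum>k. ?x k powr (- s)) holomorphic_on {s. Re s > 3/4}"
  proof (rule holomorphic_on_suminf)
    show "open {s. Re s > 3/4}" by (rule open_halfspace_Re_gt)
    show "(\<lambda>s. ?x k powr (- s)) holomorphic_on {s. Re s > 3/4}" for k
      by (intro holomorphic_intros)
    fix z :: complex assume z: "z \<in> {s. Re s > 3/4}"
    define d where "d = (Re z - 3/4) / 2"
    define M where "M k = exp (pi * (\<bar>Im z\<bar> + d)) * norm (?x k) powr (- (3/4))" for k
    have "d > 0" using z by (simp add: d_def)
    have d: "Re w \<ge> 3/4 + d" "\<bar>Im w\<bar> \<le> \<bar>Im z\<bar> + d" if "w \<in> cball z d" for w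
      using that abs_Re_le_cmod[of "z - w"] abs_Im_le_cmod[of "z - w"]
      by (auto simp: dist_norm d_def field_simps)
    have "cball z d \<subseteq> {s. Re s > 3/4}" using d \<open>d > 0\<close> by fastforce
    moreover have "summable M"
      unfolding M_def by (intro summable_mult summable_norm_pair_param[OF assms])
    moreover have "\<forall>\<^sub>F k in sequentially. \<forall>w\<in>cball z d. norm (?x k powr (- w)) \<le> M k"
      using norm_pair_param_unbounded[OF assms zero_less_one]
    proof eventually_elim
      case (elim k)
      show ?case
      proof
        fix w assume w: "w \<in> cball z d"
        have "norm (?x k powr (- w)) \<le> exp (pi * \<bar>Im w\<bar>) * norm (?x k) powr (- (3/4))"
          by (rule norm_powr_uminus_le) (use elim d(1)[OF w] \<open>d > 0\<close> in auto)
        also have "\<dots> \<le> M k"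
          unfolding M_def using d(2)[OF w] by (intro mult_right_mono) auto
        finally show "norm (?x k powr (- w)) \<le> M k" .
      qed
    qed
    ultimately show "\<exists>d>0. \<exists>M. cball z d \<subseteq> {s. Re s > 3/4} \<and> summable M \<and>
        (\<forall>\<^sub>F k in sequentially. \<forall>w\<in>cball z d. norm (?x k powr (- w)) \<le> M k)"
      using \<open>d > 0\<close> by blast
  qed
  show "(\<Sum>k. ?x k powr (- s)) = Z s" if "s \<in> {s. Re s > 3/4}" for s
    using that assms(2) by (auto simp: is_secondary_zeta_def sums_iff)
qed

section \<open>Li coefficients as combinations of secondary zeta values\<close>

text \<open>The Morgan-Voyce polynomials. For y = w + 1/w - 2 the values are (w^(n+1) + w^(-n)) / (w
  + 1) for \<open>b\<close> and (w^(n+1) - w^(-n-1)) / (w - 1/w) for \<open>B\<close>, where the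
  denominators are nonzero.\<close>

definition morgan_voyce_b :: "nat \<Rightarrow> complex \<Rightarrow> complex" where
  "morgan_voyce_b n y = (\<Sum>m\<le>n. of_nat ((n + m) choose (2 * m)) * y ^ m)"

definition morgan_voyce_B :: "nat \<Rightarrow> complex \<Rightarrow> complex" where
  "morgan_voyce_B n y = (\<Sum>m\<le>n. of_nat ((n + m + 1) choose (2 * m + 1)) * y ^ m)"

text \<open>Pascal's rule in each coefficient; the extra top term m = n + 1 is a vanishing binomial.
  The companion rule for \<open>B\<close> is proved alike, and eliminating \<open>B\<close> gives a
  three-term recurrence.\<close>

lemma morgan_voyce_b_Suc: "morgan_voyce_b (Suc n) y = morgan_voyce_b n y + y * morgan_voyce_B n y"
proof -
  have "morgan_voyce_b (Suc n) y = 1 + (\<Sum>m\<le>n. of_nat ((n + m + 2) choose (2 * m + 2)) * y ^ Suc m)"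
    unfolding morgan_voyce_b_def by (subst sum.atMost_Suc_shift) simp
  also have "(\<Sum>m\<le>n. of_nat ((n + m + 2) choose (2 * m + 2)) * y ^ Suc m) =
      (\<Sum>m\<le>n. of_nat ((n + Suc m) choose (2 * Suc m)) * y ^ Suc m) +
      y * (\<Sum>m\<le>n. of_nat ((n + m + 1) choose (2 * m + 1)) * y ^ m)"
    by (simp add: sum.distrib[symmetric] sum_distrib_left algebra_simps)
  also have "1 + (\<dots>) = (\<Sum>m\<le>Suc n. of_nat ((n + m) choose (2 * m)) * y ^ m) + y * morgan_voyce_B n y"
    by (subst sum.atMost_Suc_shift) (simp add: morgan_voyce_B_def)
  also have "(\<Sum>m\<le>Suc n. of_nat ((n + m) choose (2 * m)) * y ^ m) = morgan_voyce_b n y"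
    by (simp add: morgan_voyce_b_def binomial_eq_0)
  finally show ?thesis .
qed

lemma morgan_voyce_B_Suc: "morgan_voyce_B (Suc n) y = morgan_voyce_B n y + morgan_voyce_b (Suc n) y"
proof -
  have "morgan_voyce_B (Suc n) y =
      (\<Sum>m\<le>Suc n. of_nat ((n + m + 1) choose (2 * m + 1)) * y ^ m) + morgan_voyce_b (Suc n) y"
    unfolding morgan_voyce_B_def morgan_voyce_b_def sum.distrib[symmetric]
    by (intro sum.cong) (simp_all add: algebra_simps)
  also have "(\<Sum>m\<le>Suc n. of_nat ((n + m + 1) choose (2 * m + 1)) * y ^ m) = morgan_voyce_B n y"
    by (simp add: morgan_voyce_B_def binomial_eq_0)
  finally show ?thesis .
qed

lemma morgan_voyce_b_Suc_Suc:
  "morgan_voyce_b (Suc (Suc n)) y = (2 + y) * morgan_voyce_b (Suc n) y - morgan_voyce_b n y"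
  using morgan_voyce_b_Suc[of n y] morgan_voyce_b_Suc[of "Suc n" y] morgan_voyce_B_Suc[of n y]
  by (simp add: algebra_simps)

text \<open>Both sides satisfy the recurrence with multiplier 2 + y = w + 1/w, so two initial cases
  suffice.\<close>

lemma power_plus_inverse_power:
  fixes w y :: complex
  assumes w: "w \<noteq> 0" and y: "w + inverse w = 2 + y"
  shows "w ^ Suc n + inverse w ^ Suc n = morgan_voyce_b (Suc n) y + morgan_voyce_b n y"
proof (induction n rule: induct_nat_012)
  case 0
  then show ?case using y by (simp add: morgan_voyce_b_def numeral_2_eq_2)
next
  case 1
  have "w * inverse w = 1" using w by simp
  then have "w * w + inverse w * inverse w = (2 + y) * (2 + y) - 2"
    using y by algebra
  then show ?case
    by (simp add: morgan_voyce_b_def binomial_eq_0 numeral_eq_Suc algebra_simps)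
next
  case (ge2 n)
  have rec: "w * (w * (w * p)) + v * (v * (v * q)) =
      (w + v) * (w * (w * p) + v * (v * q)) - (w * p + v * q)"
    if "w * v = 1" for v p q
    using that by algebra
  have "w ^ Suc (Suc (Suc n)) + inverse w ^ Suc (Suc (Suc n)) =
      (w + inverse w) * (w ^ Suc (Suc n) + inverse w ^ Suc (Suc n)) - (w ^ Suc n + inverse w ^ Suc n)"
    unfolding power_Suc by (rule rec) (use w in simp)
  also have "\<dots> = (2 + y) * (morgan_voyce_b (Suc (Suc n)) y + morgan_voyce_b (Suc n) y) -
      (morgan_voyce_b (Suc n) y + morgan_voyce_b n y)"
    by (simp only: ge2 y)
  also have "\<dots> = morgan_voyce_b (Suc (Suc (Suc n))) y + morgan_voyce_b (Suc (Suc n)) y"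
    unfolding morgan_voyce_b_Suc_Suc[of "Suc n"] morgan_voyce_b_Suc_Suc[of n]
    by (simp add: algebra_simps)
  finally show ?case .
qed

text \<open>Over a common denominator the numerators combine through (n + m) + (n - m) = 2n. For m =
  n the second binomial is 0.\<close>

lemma li_binomial_coeff:
  assumes "1 \<le> m" "m \<le> n"
  shows "of_nat ((n + m) choose (2 * m)) + of_nat ((n - 1 + m) choose (2 * m)) =
    (2 * of_nat n * fact (n + m - 1) / (fact (n - m) * fact (2 * m)) :: complex)"
proof (cases "m = n")
  case True
  have "n + m = 2 * m" using True by simp
  moreover have "(n - 1 + m) choose (2 * m) = 0"
    using True assms by (intro binomial_eq_0) linarith
  moreover have "fact (2 * m) = (of_nat (2 * m) * fact (2 * m - 1) :: complex)"
    using assms by (intro fact_reduce) simp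
  moreover have "2 * of_nat n = (of_nat (2 * m) :: complex)" using True by simp
  ultimately have "2 * of_nat n * fact (n + m - 1) = (fact (2 * m) :: complex)" by (simp only:)
  then show ?thesis
    unfolding \<open>(n - 1 + m) choose (2 * m) = 0\<close> \<open>n + m = 2 * m\<close> using True
    by (simp only: binomial_n_n diff_self_eq_0 fact_0) simp
next
  case False
  then obtain k where k: "n = m + Suc k" using assms less_iff_Suc_add[of m n] by auto
  have "of_nat ((n + m) choose (2 * m)) = (fact (n + m) / (fact (2 * m) * fact (Suc k)) :: complex)"
    using binomial_fact[of "2 * m" "n + m", where ?'a = complex] k by simp
  moreover have "of_nat ((n - 1 + m) choose (2 * m)) = (fact (n + m - 1) / (fact (2 * m) * fact k) :: complex)"
    using binomial_fact[of "2 * m" "n - 1 + m", where ?'a = complex] k by simp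
  moreover have "fact (n + m) = (of_nat (n + m) * fact (n + m - 1) :: complex)"
    using fact_reduce[of "n + m", where ?'a = complex] k by simp
  moreover have "fact (Suc k) = (of_nat (Suc k) * fact k :: complex)" by simp
  moreover have "n - m = Suc k" using k by simp
  moreover have "of_nat (n + m) + of_nat (Suc k) = (2 * of_nat n :: complex)"
    using k by simp
  moreover have "a * f / (g * (c * h)) + f / (g * h) = (a + c) * f / (c * h * g)"
    if "c \<noteq> 0" "g \<noteq> 0" "h \<noteq> 0" for a c f g h :: complex
    using that by (simp add: field_simps)
  ultimately show ?thesis
    by (simp del: of_nat_Suc of_nat_add fact_Suc)
qed

lemma li_pair_term:
  fixes a b :: complex
  assumes "a + b = 1" "a \<noteq> 0" "b \<noteq> 0" "n \<ge> 1"
  shows "(1 - (1 - 1 / a) ^ n) + (1 - (1 - 1 / b) ^ n) =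
    (\<Sum>m\<in>{1..n}. - (2 * of_nat n * (-1) ^ m * fact (n + m - 1) / (fact (n - m) * fact (2 * m))) *
      inverse (a * b) ^ m)"
proof -
  define y where "y = - inverse (a * b)"
  have b: "b = 1 - a" using assms(1) by (simp add: algebra_simps)
  define w where "w = 1 - 1 / a"
  have "w \<noteq> 0" using assms by (auto simp: w_def b field_simps)
  have iw: "inverse w = 1 - 1 / b" using assms by (auto simp: w_def b field_simps)
  have y: "w + inverse w = 2 + y"
    using assms(2,3) unfolding iw by (simp add: w_def y_def b field_simps)
  obtain k where k: "n = Suc k" using assms(4) by (cases n) auto
  have "w ^ n + inverse w ^ n = morgan_voyce_b n y + morgan_voyce_b k y"
    using power_plus_inverse_power[OF \<open>w \<noteq> 0\<close> y, of k] by (simp only: k)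
  \<comment> \<open>The added term m = n is 0; the two sums now have the same range.\<close>
  also have "morgan_voyce_b k y = (\<Sum>m\<le>n. of_nat ((n - 1 + m) choose (2 * m)) * y ^ m)"
    by (simp add: morgan_voyce_b_def k binomial_eq_0)
  also have "morgan_voyce_b n y + \<dots> =
      (\<Sum>m\<le>n. (of_nat ((n + m) choose (2 * m)) + of_nat ((n - 1 + m) choose (2 * m))) * y ^ m)"
    by (simp add: morgan_voyce_b_def sum.distrib distrib_right)
  also have "{..n} = insert 0 {1..n}" by auto
  \<comment> \<open>The constant term 2 cancels the two ones of the pair, leaving only positive
    powers of 1/x.\<close>
  also have "(\<Sum>m\<in>insert 0 {1..n}. (of_nat ((n + m) choose (2 * m)) + of_nat ((n - 1 + m) choose (2 * m))) * y ^ m) =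
      2 + (\<Sum>m\<in>{1..n}. (of_nat ((n + m) choose (2 * m)) + of_nat ((n - 1 + m) choose (2 * m))) * y ^ m)"
    by simp
  also have "(\<Sum>m\<in>{1..n}. (of_nat ((n + m) choose (2 * m)) + of_nat ((n - 1 + m) choose (2 * m))) * y ^ m) =
      (\<Sum>m\<in>{1..n}. 2 * of_nat n * fact (n + m - 1) / (fact (n - m) * fact (2 * m)) * y ^ m)"
    by (intro sum.cong refl) (simp only: li_binomial_coeff atLeastAtMost_iff)
  finally have "(1 - w ^ n) + (1 - inverse w ^ n) =
      - (\<Sum>m\<in>{1..n}. 2 * of_nat n * fact (n + m - 1) / (fact (n - m) * fact (2 * m)) * y ^ m)"
    by (simp add: algebra_simps)
  also have "\<dots> = (\<Sum>m\<in>{1..n}. - (2 * of_nat n * (-1) ^ m * fact (n + m - 1) / (fact (n - m) * fact (2 * m))) *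
      inverse (a * b) ^ m)"
    unfolding sum_negf[symmetric] y_def power_minus[of "inverse _"]
    by (intro sum.cong refl) simp
  finally show ?thesis unfolding iw by (simp only: w_def)
qed

text \<open>The sum over \<open>m\<close> is finite, so it may be exchanged with the series over the
  zeros; each m >= 1 lies in the half-plane where that series equals \<open>Z\<close>.\<close>

lemma li_coeff_eq:
  assumes "zero_pair_listing \<tau>" "is_secondary_zeta \<tau> Z" "n \<ge> 1"
  shows "li_coeff \<tau> n = (\<Sum>m\<in>{1..n}.
    - (2 * of_nat n * (-1) ^ m * fact (n + m - 1) / (fact (n - m) * fact (2 * m))) * Z (of_nat m))"
proof -
  let ?x = "pair_param \<tau>"
  let ?c = "\<lambda>m. - (2 * of_nat n * (-1) ^ m * fact (n + m - 1) / (fact (n - m) * fact (2 * m))) :: complex"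
  have "(1 - (1 - 1 / (1/2 + \<i> * \<tau> k)) ^ n) + (1 - (1 - 1 / (1/2 - \<i> * \<tau> k)) ^ n) =
      (\<Sum>m\<in>{1..n}. ?c m * inverse (?x k) ^ m)" for k
  proof -
    have "(1/2 + \<i> * \<tau> k) * (1/2 - \<i> * \<tau> k) = ?x k"
      by (simp add: pair_param_def algebra_simps power2_eq_square)
    moreover have "(1/2 + \<i> * \<tau> k) + (1/2 - \<i> * \<tau> k) = 1" by simp
    ultimately show ?thesis
      using li_pair_term[OF _ pair_param_nonzero(1,2)[OF assms(1)] assms(3), of k k] by simp
  qed
  moreover have "(\<lambda>k. inverse (?x k) ^ m) sums Z (of_nat m)" if "m \<in> {1..n}" for m
  proof -
    have "?x k powr (- of_nat m) = inverse (?x k) ^ m" for k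
      using pair_param_nonzero(3)[OF assms(1), of k]
      by (simp add: powr_minus powr_nat' power_inverse)
    then show ?thesis
      using assms(2) that by (auto simp: is_secondary_zeta_def dest!: spec[of _ "of_nat m"])
  qed
  then have "(\<lambda>k. \<Sum>m\<in>{1..n}. ?c m * inverse (?x k) ^ m) sums (\<Sum>m\<in>{1..n}. ?c m * Z (of_nat m))"
    by (intro sums_sum sums_mult)
  ultimately show ?thesis
    unfolding li_coeff_def by (simp add: sums_iff)
qed

section \<open>Residues of the integrand\<close>

definition li_product :: "(complex \<Rightarrow> complex) \<Rightarrow> nat \<Rightarrow> complex \<Rightarrow> complex" where
  "li_product Z n s = Gamma (s + of_nat n) * Gamma (s - of_nat n) / Gamma (2 * s + 1) * Z s"

lemma li_integrand_eq: "li_integrand Z n = remove_sings (li_product Z n)"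
  by (simp add: li_integrand_def li_product_def[abs_def])

text \<open>\<open>Gamma\<close> is the reciprocal of the entire function \<open>rGamma\<close>,
  also at its poles, where both conventions give 0.\<close>

lemma li_product_meromorphic:
  assumes "Z meromorphic_on UNIV"
  shows "li_product Z n meromorphic_on UNIV"
proof -
  have "(\<lambda>s. Gamma (f s)) meromorphic_on UNIV" if "f holomorphic_on UNIV" for f :: "complex \<Rightarrow> complex"
  proof -
    have "(\<lambda>s. rGamma (f s)) meromorphic_on UNIV"
      using that by (intro analytic_on_imp_meromorphic_on analytic_intros) (simp add: analytic_on_open)
    then have "(\<lambda>s. inverse (rGamma (f s))) meromorphic_on UNIV"
      by (rule meromorphic_on_inverse)
    then show ?thesis by (simp add: rGamma_inverse_Gamma)
  qed
  then show ?thesis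
    unfolding li_product_def
    by (intro meromorphic_on_mult meromorphic_on_divide assms) (auto intro!: holomorphic_intros)
qed

text \<open>Near \<open>m\<close> only \<open>Gamma (s - of_nat n)\<close> is singular, with the
  simple pole of \<open>Gamma\<close> at -(n - m); the other factors are holomorphic there and are
  evaluated at \<open>m\<close>.\<close>

lemma li_product_residue:
  assumes Z: "Z holomorphic_on {s. Re s > 3/4}" and m: "1 \<le> m" "m \<le> n"
  shows "residue (li_product Z n) (of_nat m) =
    (-1) ^ (n - m) * fact (n + m - 1) / (fact (n - m) * fact (2 * m)) * Z (of_nat m)"
proof (rule residue_simple')
  \<comment> \<open>Radius 1/4 keeps the disc inside Re s > 3/4 and away from all other
    integers.\<close>
  let ?S = "ball (of_nat m :: complex) (1/4)"
  have Re: "Re s > 3/4" if "s \<in> ?S" for s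
    using that abs_Re_le_cmod[of "of_nat m - s"] m by (simp add: dist_norm)
  show "open ?S" "of_nat m \<in> ?S" by auto
  have nonint: "s - of_nat n \<notin> \<int>\<^sub>\<le>\<^sub>0" if s: "s \<in> ?S - {of_nat m}" for s
  proof
    assume "s - of_nat n \<in> \<int>\<^sub>\<le>\<^sub>0"
    then obtain j where "s - of_nat n = - of_nat j" by (auto elim: nonpos_Ints_cases')
    then have s_eq: "of_nat m - s = of_int (int m - int n + int j)" by (simp add: algebra_simps)
    have "norm (of_nat m - s) < 1" using s by (simp add: dist_norm)
    then have "\<bar>int m - int n + int j\<bar> < 1" unfolding s_eq norm_of_int by linarith
    then have "int m - int n + int j = 0" by simp
    then have "of_nat m - s = 0" unfolding s_eq by (simp only: of_int_0)
    then show False using s by simp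
  qed
  have pos: "s \<notin> \<int>\<^sub>\<le>\<^sub>0" if "Re s > 0" for s :: complex
    using that by (auto elim!: nonpos_Ints_cases)
  let ?h = "\<lambda>s. Gamma (s + of_nat n) / Gamma (2 * s + 1) * Z s"
  have h: "?h holomorphic_on {s. Re s > 3/4}"
    by (intro holomorphic_intros Z) (auto simp: Gamma_eq_zero_iff intro!: pos)
  show "li_product Z n holomorphic_on (?S - {of_nat m})"
  proof -
    have "(\<lambda>s. Gamma (s - of_nat n) * ?h s) holomorphic_on (?S - {of_nat m})"
      using nonint Re
      by (intro holomorphic_on_mult holomorphic_Gamma' holomorphic_on_subset[OF h])
         (auto intro!: holomorphic_intros)
    then show ?thesis by (simp add: li_product_def[abs_def] mult_ac)
  qed
  have "isCont ?h (of_nat m)"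
    by (rule continuous_on_interior[OF holomorphic_on_imp_continuous_on[OF h]])
       (unfold interior_open[OF open_halfspace_Re_gt], use m in simp)
  then have "?h \<midarrow>of_nat m\<rightarrow> ?h (of_nat m)" by (simp add: isCont_def)
  moreover have "(\<lambda>s. Gamma (s - of_nat n :: complex) * (s - of_nat m)) \<midarrow>of_nat m\<rightarrow> (-1) ^ (n - m) / fact (n - m)"
    using LIM_offset[OF Gamma_residues[of "n - m", where ?'a = complex], of "- of_nat n"] m
    by (simp add: of_nat_diff algebra_simps)
  ultimately have "(\<lambda>s. ?h s * (Gamma (s - of_nat n) * (s - of_nat m))) \<midarrow>of_nat m\<rightarrow>
      ?h (of_nat m) * ((-1) ^ (n - m) / fact (n - m))"
    by (rule tendsto_mult)
  moreover have "Gamma (of_nat m + of_nat n) = (fact (n + m - 1) :: complex)"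
    using Gamma_fact[of "n + m - 1", where ?'a = complex] m by (simp add: of_nat_diff algebra_simps)
  moreover have "Gamma (2 * of_nat m + 1) = (fact (2 * m) :: complex)"
    using Gamma_fact[of "2 * m", where ?'a = complex] by (simp add: add.commute)
  ultimately show "(\<lambda>s. li_product Z n s * (s - of_nat m)) \<midarrow>of_nat m\<rightarrow>
      (-1) ^ (n - m) * fact (n + m - 1) / (fact (n - m) * fact (2 * m)) * Z (of_nat m)"
    by (simp add: li_product_def mult_ac)
qed

section \<open>Evaluation of the contour integral\<close>

text \<open>There may be infinitely many poles, while the residue theorem takes finitely many. A
  large ball around the contour contains finitely many, and winding numbers vanish outside
  it.\<close>

lemma contour_integral_encircles_only:
  assumes f: "f nicely_meromorphic_on UNIV" and A: "finite A" and C: "encircles_only C f A"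
  shows "contour_integral C f = 2 * pi * \<i> * (\<Sum>p\<in>A. residue f p)"
proof -
  have path: "valid_path C" "pathfinish C = pathstart C"
    and avoid: "path_image C \<inter> (A \<union> {s. is_pole f s}) = {}"
    and wind_A: "\<And>s. s \<in> A \<Longrightarrow> winding_number C s = 1"
    and wind_pole: "\<And>s. is_pole f s \<Longrightarrow> s \<notin> A \<Longrightarrow> winding_number C s = 0"
    using C by (auto simp: encircles_only_def)
  have "bounded (path_image C \<union> A)"
    using path(1) A by (simp add: bounded_path_image valid_path_imp_path finite_imp_bounded)
  then obtain R where R: "path_image C \<union> A \<subseteq> ball 0 R"
    using bounded_subset_ballD by blast
  \<comment> \<open>All of \<open>A\<close> is included, even points where a zero of
    \<open>Z\<close> cancels the pole.\<close>
  define P where "P = (A \<union> {s. is_pole f s}) \<inter> ball 0 R"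
  have "f meromorphic_on UNIV" using f by (simp add: nicely_meromorphic_on_def)
  then have "{s. \<not> f analytic_on {s}} sparse_in UNIV"
    by (rule meromorphic_on_imp_sparse_singularities)
  then have "finite (cball 0 R \<inter> {s. \<not> f analytic_on {s}})"
    by (intro sparse_in_compact_finite) (auto intro: sparse_in_subset)
  then have "finite (A \<union> (cball 0 R \<inter> {s. \<not> f analytic_on {s}}))" using A by simp
  then have "finite P"
    by (rule finite_subset[rotated]) (auto simp: P_def dest: analytic_at_imp_no_pole)
  moreover have "f holomorphic_on ball 0 R - P"
  proof -
    have "f analytic_on {s}" if "s \<in> ball 0 R - P" for s
      using that f by (intro nicely_meromorphic_on_imp_analytic_at[of f UNIV]) (auto simp: P_def)
    then have "f analytic_on ball 0 R - P" using analytic_on_analytic_at by blast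
    then show ?thesis by (rule analytic_imp_holomorphic)
  qed
  moreover have "path_image C \<subseteq> ball 0 R - P" using R avoid by (auto simp: P_def)
  moreover have "\<forall>z. z \<notin> ball 0 R \<longrightarrow> winding_number C z = 0"
    using R path by (auto intro!: winding_number_zero_outside[of C "ball 0 R"] valid_path_imp_path)
  ultimately have "contour_integral C f = 2 * pi * \<i> * (\<Sum>p\<in>P. winding_number C p * residue f p)"
    using path by (intro Residue_theorem[of "ball 0 R"]) auto
  also have "(\<Sum>p\<in>P. winding_number C p * residue f p) = (\<Sum>p\<in>A. winding_number C p * residue f p)"
    by (rule sum.mono_neutral_right) (use \<open>finite P\<close> R wind_pole in \<open>auto simp: P_def\<close>)
  also have "\<dots> = (\<Sum>p\<in>A. residue f p)"
    by (intro sum.cong refl) (simp add: wind_A)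
  finally show ?thesis .
qed

theorem mainTheorem2:
  fixes \<tau> :: "nat \<Rightarrow> complex" and Z :: "complex \<Rightarrow> complex"
    and n :: nat and C :: "real \<Rightarrow> complex"
  assumes "zero_pair_listing \<tau>"
    and "is_secondary_zeta \<tau> Z"
    and "n \<ge> 1"
    and "encircles_only C (li_integrand Z n) (of_nat ` {1..n})"
  shows "li_coeff \<tau> n =
    (-1) ^ n * of_nat n * \<i> / of_real pi * contour_integral C (li_integrand Z n)"
proof -
  have mero: "li_product Z n meromorphic_on UNIV"
    using assms(2) by (intro li_product_meromorphic) (simp add: is_secondary_zeta_def)
  have "residue (li_integrand Z n) s = residue (li_product Z n) s" for s
    unfolding li_integrand_eq
    using mero by (intro residue_remove_sings) (auto simp: meromorphic_on_altdef)
  moreover have "li_integrand Z n nicely_meromorphic_on UNIV"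
    unfolding li_integrand_eq by (rule remove_sings_nicely_meromorphic[OF mero])
  ultimately have "contour_integral C (li_integrand Z n) =
      2 * pi * \<i> * (\<Sum>m\<in>{1..n}. residue (li_product Z n) (of_nat m))"
    using contour_integral_encircles_only[OF _ _ assms(4)]
    by (simp add: sum.reindex inj_on_def)
  also have "(\<Sum>m\<in>{1..n}. residue (li_product Z n) (of_nat m)) = (\<Sum>m\<in>{1..n}.
      (-1) ^ (n - m) * fact (n + m - 1) / (fact (n - m) * fact (2 * m)) * Z (of_nat m))"
    by (intro sum.cong refl li_product_residue secondary_zeta_holomorphic[OF assms(1,2)]) auto
  \<comment> \<open>The constant -2 is the product of 2 pi i and i/pi.\<close>
  finally have "(-1) ^ n * of_nat n * \<i> / of_real pi * contour_integral C (li_integrand Z n) =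
      (\<Sum>m\<in>{1..n}. - 2 * of_nat n * ((-1) ^ n * (-1) ^ (n - m)) *
        (fact (n + m - 1) / (fact (n - m) * fact (2 * m)) * Z (of_nat m)))"
    by (simp add: sum_distrib_left mult_ac)
  also have "\<dots> = li_coeff \<tau> n"
    unfolding li_coeff_eq[OF assms(1-3)]
  proof (rule sum.cong[OF refl])
    fix m assume "m \<in> {1..n}"
    then have "(-1) ^ n = ((-1) ^ m * (-1) ^ (n - m) :: complex)"
      by (simp flip: power_add)
    then have "(-1) ^ n * (-1) ^ (n - m) = ((-1) ^ m :: complex)"
      by (simp add: mult.assoc flip: power_mult_distrib)
    then show "- 2 * of_nat n * ((-1) ^ n * (-1) ^ (n - m)) *
        (fact (n + m - 1) / (fact (n - m) * fact (2 * m)) * Z (of_nat m)) =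
      - (2 * of_nat n * (-1) ^ m * fact (n + m - 1) / (fact (n - m) * fact (2 * m))) * Z (of_nat m)"
      by simp
  qed
  finally show ?thesis ..
qed

end
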